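(* For every integer $n\ge 1$, $$|\mathcal{S}_n(23;\,1\to 1)| = d_n + d_{n-1} + \sum_{m=1}^{n-1}\sum_{r=0}^{m-1}\binom{m-1}{r}\binom{n-m+r-1}{r}\, r!\; d_{m-1-r},$$ where $d_j$ denotes the $j$-th derangement number.
   Context: $[n]=\{1,\dots,n\}$, and $\mathcal{S}_n$ is the set of permutations $\pi=\pi_1\pi_2\cdots\pi_n$ of $[n]$ in one-line notation. The permutation $\hat\pi$: for $\pi\in\mathcal{S}_n$, $\hat\pi\in\mathcal{S}_n$ is the permutation whose cycle form is obtained from the word $\pi_1\cdots\pi_n$ by inserting a left parenthesis before each left-to-right maximum (an entry larger than all entries to its left) and a right parenthesis immediately before the next left-to-right maximum, or at the end of the word. A cycle $(c_1,c_2,\dots,c_s)$ means $c_1\mapsto c_2\mapsto\cdots\mapsto c_s\mapsto c_1$. Example: if $\pi=2537164$ then $\hat\pi=(2)(53)(7164)$. Arrow patterns: an arrow pattern of size $k$ is a pair $(\nu;H)$ where $\nu=\nu_1\cdots\nu_m$ is a word of distinct positive integers, $H$ is a collection of arrows $b_i\to c_i$, and the set of all integers appearing in $\nu$ or $H$ is $[k]$. A permutation $\pi\in\mathcal{S}_n$ contains $(\nu;H)$ if there are a set $X=\{x_1<x_2<\cdots<x_k\}\subseteq[n]$ and indices $t_1<\cdots<t_m$ such that $\pi_{t_1}\pi_{t_2}\cdots\pi_{t_m}=x_{\nu_1}x_{\nu_2}\cdots x_{\nu_m}$ and $\hat\pi(x_{b_i})=x_{c_i}$ for every arrow $b_i\to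 c_i$ in $H$. Otherwise $\pi$ avoids $(\nu;H)$. $\mathcal{S}_n(\nu;H)$ is the set of permutations in $\mathcal{S}_n$ avoiding $(\nu;H)$. The derangement number $d_j$ is the number of permutations of $[j]$ without fixed points ($d_0=1$, $d_1=0$). *)

theory Defs
  imports "HOL-Combinatorics.Combinatorics"
begin

text \<open>
  A permutation of \<open>[n] = {1..n}\<close> in one-line notation is a list
  \<open>w \<in> permutations_of_set {1..n}\<close>. Letters are numbered from 1,
  but positions in the list are numbered from 0.
\<close>

definition lr_max :: "nat list \<Rightarrow> nat \<Rightarrow> bool" where
  "lr_max w i \<longleftrightarrow> i < length w \<and> (\<forall>j<i. w ! j < w ! i)"

definition lr_max_positions :: "nat list \<Rightarrow> nat list" where
  "lr_max_positions w = filter (lr_max w) [0..<length w]"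

text \<open>
  The parenthesised words: each one starts at a left-to-right maximum and ends just
  before the next one, or at the end of \<open>w\<close>.
\<close>

definition lr_max_blocks :: "nat list \<Rightarrow> nat list list" where
  "lr_max_blocks w =
     (let ps = lr_max_positions w
      in map2 (\<lambda>i j. take (j - i) (drop i w)) ps (tl ps @ [length w]))"

definition hat :: "nat list \<Rightarrow> nat \<Rightarrow> nat" where
  "hat w = foldr (\<circ>) (map cycle_of_list (lr_max_blocks w)) id"

lemma lr_max_blocks_example:
  "lr_max_blocks [2,5,3,7,1,6,4] = [[2], [5,3], [7,1,6,4]]"
  by code_simp

lemma hat_example:
  "map (hat [2,5,3,7,1,6,4]) [1,2,3,4,5,6,7] = [6,2,5,7,3,4,1]"
  by code_simp

text \<open>
  A pair \<open>(\<nu>, H)\<close>, where \<open>(b, c) \<in> H\<close> stands for the arrow from \<open>b\<close> to \<open>c\<close>.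
\<close>

type_synonym arrow_pattern = "nat list \<times> (nat \<times> nat) set"

definition pattern_letters :: "arrow_pattern \<Rightarrow> nat set" where
  "pattern_letters p = set (fst p) \<union> fst ` snd p \<union> snd ` snd p"

definition is_arrow_pattern :: "nat \<Rightarrow> arrow_pattern \<Rightarrow> bool" where
  "is_arrow_pattern k p \<longleftrightarrow> distinct (fst p) \<and> pattern_letters p = {1..k}"

definition pattern_size :: "arrow_pattern \<Rightarrow> nat" where
  "pattern_size p = card (pattern_letters p)"

lemma pattern_size_eq: "is_arrow_pattern k p \<Longrightarrow> pattern_size p = k"
  by (simp add: is_arrow_pattern_def pattern_size_def)

text \<open>
  The set \<open>X = {x\<^sub>1 < \<dots> < x\<^sub>k}\<close> is given by its increasing enumeration \<open>x\<close> on \<open>{1..k}\<close>.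
\<close>

definition contains_arrow :: "nat list \<Rightarrow> arrow_pattern \<Rightarrow> bool" where
  "contains_arrow w p \<longleftrightarrow>
     (let k = pattern_size p; \<nu> = fst p; H = snd p; n = length w; m = length \<nu> in
      \<exists>(x :: nat \<Rightarrow> nat) (t :: nat \<Rightarrow> nat).
        strict_mono_on {1..k} x \<and> x ` {1..k} \<subseteq> {1..n} \<and>
        strict_mono_on {..<m} t \<and> t ` {..<m} \<subseteq> {..<n} \<and>
        (\<forall>j<m. w ! t j = x (\<nu> ! j)) \<and>
        (\<forall>(b, c)\<in>H. hat w (x b) = x c))"

definition arrow_avoiders :: "nat \<Rightarrow> arrow_pattern \<Rightarrow> nat list set" where
  "arrow_avoiders n p = {w \<in> permutations_of_set {1..n}. \<not> contains_arrow w p}"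

lemma is_arrow_pattern_23_1_1: "is_arrow_pattern 3 ([2, 3], {(1, 1)})"
  by (auto simp: is_arrow_pattern_def pattern_letters_def)

definition derangement_number :: "nat \<Rightarrow> nat" where
  "derangement_number j = card {f. f permutes {1..j} \<and> (\<forall>i\<in>{1..j}. f i \<noteq> i)}"

lemma derangement_number_0: "derangement_number 0 = 1"
  by (simp add: derangement_number_def)

lemma derangement_number_1: "derangement_number 1 = 0"
  by (simp add: derangement_number_def)

end

theory Submission
  imports Defs
begin

text \<open>
  A word avoids the pattern iff \<open>hat w\<close> has no fixed point or the letters larger than its smallest
  fixed point \<open>m\<close> appear in decreasing order. By Foata's bijection there are \<open>d\<^sub>n\<close> words without fixed
  points, and those with \<open>m = n\<close> arise by appending \<open>n\<close> to a fixed point free word on \<open>[n-1]\<close>.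
  For \<open>m < n\<close> the block \<open>(m)\<close> must be followed immediately by \<open>n\<close>, so \<open>w = A m n B\<close>: if \<open>R\<close> is
  the set of letters of \<open>B\<close> below \<open>m\<close> and \<open>r = |R|\<close>, then \<open>A\<close> is a fixed point free word on
  \<open>[m-1] - R\<close>, and \<open>B\<close> is a shuffle of any ordering of \<open>R\<close> with the decreasing word
  \<open>(n-1) \<dots> (m+1)\<close>.
\<close>

section \<open>Foata's bijection\<close>

text \<open>The maximum is the last left-to-right maximum, so \<open>M # B\<close> is the last block
  and \<open>A\<close> carries the other blocks. The induction thus removes one block at a time from
  the right.\<close>

lemma max_split_induct [consumes 1, case_names Nil split]:
  fixes w :: "nat list"
  assumes "distinct w"
    and "P []"
    and step: "\<And>A M B. \<lbrakk>distinct (A @ M # B); \<forall>x\<in>set A \<union> set B. x < M; P A\<rbrakk> \<Longrightarrow> P (A @ M # B)"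
  shows "P w"
  using assms(1)
proof (induction "length w" arbitrary: w rule: less_induct)
  case less
  show ?case
  proof (cases "w = []")
    case False
    then have "Max (set w) \<in> set w" by simp
    then obtain A M B where w: "w = A @ M # B" and M: "M = Max (set w)" by (metis split_list)
    have d: "distinct (A @ M # B)" using w less.prems by simp
    have len: "length A < length w" using w by simp
    have lt: "\<forall>x\<in>set A \<union> set B. x < M"
    proof
      fix x assume x: "x \<in> set A \<union> set B"
      then have "x \<le> M" unfolding M using w by (intro Max_ge) auto
      moreover have "x \<noteq> M" using x d by auto
      ultimately show "x < M" by simp
    qed
    have "P A" using less.hyps[OF len] d by simp
    then show ?thesis using step[OF d lt] w by simp
  qed (use assms(2) in simp)
qed

lemma max_split:
  fixes w :: "nat list"
  assumes "distinct w" "w \<noteq> []"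
  obtains A M B where "w = A @ M # B" "\<forall>x\<in>set A \<union> set B. x < M"
  using assms by (induction rule: max_split_induct) auto

section \<open>Blocks and \<open>hat\<close> of a word cut at its maximum\<close>

lemma lr_max_positions_append_max:
  assumes "\<forall>x\<in>set A \<union> set B. x < M"
  shows "lr_max_positions (A @ M # B) = lr_max_positions A @ [length A]"
proof -
  let ?w = "A @ M # B"
  have "[0..<length ?w] = [0..<length A] @ length A # [Suc (length A)..<length ?w]"
    using upt_add_eq_append[of 0 "length A" "Suc (length B)"] by (simp add: upt_conv_Cons del: upt_Suc)
  moreover have "filter (lr_max ?w) [0..<length A] = filter (lr_max A) [0..<length A]"
    by (rule filter_cong) (auto simp: lr_max_def nth_append)
  moreover have "lr_max ?w (length A)"
    using assms by (auto simp: lr_max_def nth_append)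
  moreover have "filter (lr_max ?w) [Suc (length A)..<length ?w] = []"
  proof (subst filter_empty_conv, intro ballI notI)
    fix i assume i: "i \<in> set [Suc (length A)..<length ?w]" and l: "lr_max ?w i"
    have "length A < i" "i < length ?w" using i by auto
    then have "?w ! i = B ! (i - Suc (length A))" "i - Suc (length A) < length B"
      by (auto simp: nth_append nth_Cons')
    then have "?w ! i < M" using assms by simp
    moreover have "?w ! length A < ?w ! i" using l \<open>length A < i\<close> by (auto simp: lr_max_def)
    ultimately show False by simp
  qed
  ultimately show ?thesis by (simp add: lr_max_positions_def)
qed

text \<open>Serves the pairing of consecutive block starts in \<open>lr_max_blocks\<close>: a new
  last position \<open>a\<close> both closes the previous block and opens one that ends at
  \<open>b\<close>.\<close>

lemma map2_snoc_tl:
  assumes "ps \<noteq> []"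
  shows "map2 f (ps @ [a]) (tl (ps @ [a]) @ [b]) = map2 f ps (tl ps @ [a]) @ [f a b]"
proof -
  have "tl (ps @ [a]) = tl ps @ [a]" "length ps = length (tl ps @ [a])" using assms by simp_all
  then show ?thesis using zip_append[of ps "tl ps @ [a]" "[a]" "[b]"] by simp
qed

lemma lr_max_blocks_append_max:
  assumes "\<forall>x\<in>set A \<union> set B. x < M"
  shows "lr_max_blocks (A @ M # B) = lr_max_blocks A @ [M # B]"
proof (cases "A = []")
  case True
  then show ?thesis
    using lr_max_positions_append_max[OF assms] by (simp add: lr_max_blocks_def lr_max_positions_def)
next
  case False
  let ?ps = "lr_max_positions A" and ?w = "A @ M # B"
  let ?f = "\<lambda>i j. take (j - i) (drop i ?w)"
  have "0 \<in> set ?ps" using False by (simp add: lr_max_positions_def lr_max_def)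
  then have ne: "?ps \<noteq> []" by auto
  have "set (tl ?ps) \<subseteq> set ?ps" using list.set_sel(2)[OF ne] by blast
  then have "set (tl ?ps @ [length A]) \<subseteq> {..length A}" by (auto simp: lr_max_positions_def)
  \<comment> \<open>As every right end \<open>j\<close> is at most \<open>length A\<close>, cutting
    from \<open>i\<close> to \<open>j\<close> gives the same block in the whole word as in
    \<open>A\<close>.\<close>
  then have le: "j \<le> length A" if "(i, j) \<in> set (zip ?ps (tl ?ps @ [length A]))" for i j
    using that by (auto dest!: set_zip_rightD)
  have "lr_max_blocks ?w = map2 ?f ?ps (tl ?ps @ [length A]) @ [?f (length A) (length ?w)]"
    unfolding lr_max_blocks_def Let_def lr_max_positions_append_max[OF assms]
    by (rule map2_snoc_tl[OF ne])
  also have "map2 ?f ?ps (tl ?ps @ [length A]) = lr_max_blocks A"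
    unfolding lr_max_blocks_def Let_def by (rule map_cong[OF refl]) (auto dest: le)
  finally show ?thesis by simp
qed

lemma hat_Nil [simp]: "hat [] = id"
  by (simp add: hat_def lr_max_blocks_def lr_max_positions_def)

lemma foldr_comp_snoc: "foldr (\<circ>) (fs @ [g]) id = foldr (\<circ>) fs id \<circ> g"
  by (induction fs) (auto simp: comp_assoc)

lemma hat_append_max:
  assumes "\<forall>x\<in>set A \<union> set B. x < M"
  shows "hat (A @ M # B) = hat A \<circ> cycle_of_list (M # B)"
  unfolding hat_def lr_max_blocks_append_max[OF assms] map_append list.map by (rule foldr_comp_snoc)

lemma hat_permutes: "distinct w \<Longrightarrow> hat w permutes set w"
proof (induction rule: max_split_induct)
  case (split A M B)
  have "cycle_of_list (M # B) permutes set (A @ M # B)"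
    by (rule permutes_subset[OF cycle_permutes]) auto
  moreover have "hat A permutes set (A @ M # B)"
    by (rule permutes_subset[OF split.IH]) auto
  ultimately show ?case
    unfolding hat_append_max[OF split.hyps(2)] by (rule permutes_compose)
qed (simp add: permutes_id flip: id_def)

text \<open>The cycle maps the letters of the last block among themselves, where
  \<open>hat A\<close> is the identity, and it fixes every other letter.\<close>

lemma hat_append_max_apply:
  assumes "distinct (A @ M # B)" "\<forall>x\<in>set A \<union> set B. x < M"
  shows "hat (A @ M # B) x = (if x \<in> set (M # B) then cycle_of_list (M # B) x else hat A x)"
proof (cases "x \<in> set (M # B)")
  case True
  then have "cycle_of_list (M # B) x \<in> set (M # B)"
    by (simp only: permutes_in_image[OF cycle_permutes])
  then have "cycle_of_list (M # B) x \<notin> set A" using assms(1) by auto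
  moreover have "hat A permutes set A" using assms(1) by (intro hat_permutes) simp
  ultimately show ?thesis
    using True by (simp add: hat_append_max[OF assms(2)] permutes_not_in del: cycle_of_list.simps)
next
  case False
  then show ?thesis by (simp add: hat_append_max[OF assms(2)] id_outside_supp del: cycle_of_list.simps)
qed

section \<open>Recovering a word from the orbits of \<open>hat\<close>\<close>

text \<open>Applying a power of the cycle to its own list rotates the list, so the iterates of the
  head read off the list periodically.\<close>

lemma funpow_cycle_of_list_hd:
  assumes "distinct cs" "cs \<noteq> []"
  shows "(cycle_of_list cs ^^ i) (hd cs) = cs ! (i mod length cs)"
proof -
  have "(cycle_of_list cs ^^ i) (hd cs) = hd (map (cycle_of_list cs ^^ i) cs)"
    using assms by (simp add: hd_map)
  also have "\<dots> = cs ! (i mod length cs)"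
    using assms by (simp add: cyclic_rotation hd_rotate_conv_nth)
  finally show ?thesis .
qed

text \<open>Otherwise at index \<open>length cs\<close> the first sequence is back at its start,
  while the second still shows a letter distinct from its own start.\<close>

lemma periodic_nth_length_le:
  assumes "distinct cs'" "cs \<noteq> []"
    and eq: "\<And>i. cs ! (i mod length cs) = cs' ! (i mod length cs')"
  shows "length cs' \<le> length cs"
proof (rule ccontr)
  assume "\<not> ?thesis"
  then have l: "length cs < length cs'" by simp
  have "cs' ! length cs = cs' ! 0" using eq[of "length cs"] eq[of 0] l assms(2) by simp
  moreover have "0 < length cs'" using l by linarith
  ultimately have "length cs = 0" using nth_eq_iff_index_eq[OF assms(1) l] by blast
  then show False using assms(2) by simp
qed

text \<open>A cycle alone fixes its list only up to rotation; reading both lists from index 0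
  removes this ambiguity.\<close>

lemma periodic_nth_eqD:
  assumes "distinct cs" "distinct cs'" "cs \<noteq> []" "cs' \<noteq> []"
    and eq: "\<And>i. cs ! (i mod length cs) = cs' ! (i mod length cs')"
  shows "cs = cs'"
proof (rule nth_equalityI)
  show l: "length cs = length cs'"
    using periodic_nth_length_le[of cs' cs] periodic_nth_length_le[of cs cs'] assms
    by (simp add: order_antisym)
  show "cs ! i = cs' ! i" if "i < length cs" for i using eq[of i] that l by simp
qed

lemma funpow_hat_max:
  assumes "distinct (A @ M # B)" "\<forall>x\<in>set A \<union> set B. x < M"
  shows "(hat (A @ M # B) ^^ i) M = (M # B) ! (i mod length (M # B))"
proof -
  have d: "distinct (M # B)" using assms(1) by simp
  have "(hat (A @ M # B) ^^ i) M = (cycle_of_list (M # B) ^^ i) (hd (M # B))"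
  proof (induction i)
    case (Suc i)
    have "(cycle_of_list (M # B) ^^ i) (hd (M # B)) \<in> set (M # B)"
      unfolding funpow_cycle_of_list_hd[OF d list.distinct(2)] by (rule nth_mem) simp
    then show ?case
      using hat_append_max_apply[OF assms, of "(cycle_of_list (M # B) ^^ i) (hd (M # B))"]
      by (simp only: Suc.IH funpow.simps comp_apply if_True)
  qed simp
  then show ?thesis unfolding funpow_cycle_of_list_hd[OF d list.distinct(2)] .
qed

text \<open>The orbit of the maximum recovers the last block; the rest is recovered by induction.\<close>

lemma hat_inject:
  assumes "distinct w" "distinct w'" "set w = set w'" "hat w = hat w'"
  shows "w = w'"
  using assms
proof (induction arbitrary: w' rule: max_split_induct)
  case (split A M B)
  have "w' \<noteq> []" using split.prems by auto
  then obtain A' M' B' where w': "w' = A' @ M' # B'" and lt': "\<forall>x\<in>set A' \<union> set B'. x < M'"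
    using max_split split.prems(1) by metis
  have d': "distinct (A' @ M' # B')" using split.prems w' by simp
  have s: "insert M (set A \<union> set B) = insert M' (set A' \<union> set B')"
    using split.prems(2) w' by simp
  have M': "M' = M"
  proof (rule order_antisym)
    have "M \<in> insert M' (set A' \<union> set B')" "M' \<in> insert M (set A \<union> set B)"
      using s by (metis insertI1)+
    then show "M \<le> M'" "M' \<le> M" using lt' split.hyps(2) by (metis insertE less_imp_le order_refl)+
  qed
  have h: "hat (A' @ M' # B') = hat (A @ M # B)" using split.prems(3) w' by simp
  have "M # B = M # B'"
  proof (rule periodic_nth_eqD)
    show "(M # B) ! (i mod length (M # B)) = (M # B') ! (i mod length (M # B'))" for i
      using funpow_hat_max[OF split.hyps(1,2), of i] funpow_hat_max[OF d' lt', of i]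
      unfolding M' h[unfolded M'] by (rule trans[OF sym])
  qed (use split.hyps(1) d' M' in simp_all)
  then have B': "B' = B" by simp
  have sA: "set A = set A'" using split.prems(2) split.hyps(1) d' w' M' B' by auto
  \<comment> \<open>On \<open>set A\<close> both sides are values of the common permutation; outside
    it both are the identity.\<close>
  have "hat A x = hat A' x" for x
  proof (cases "x \<in> set A")
    case True
    then have "x \<notin> set (M # B)" using split.hyps(1) by auto
    then show ?thesis
      using hat_append_max_apply[OF split.hyps(1,2), of x] hat_append_max_apply[OF d' lt', of x]
      unfolding M' B' h[unfolded M' B'] by (simp only: if_False)
  next
    case False
    then show ?thesis using hat_permutes[of A] hat_permutes[of A'] split.hyps(1) d' sA
      by (simp add: permutes_not_in)
  qed
  then have "A = A'" using split.IH[of A'] sA d' by auto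
  then show ?case using w' M' B' by simp
qed simp

section \<open>Fixed points of \<open>hat\<close> and derangement numbers\<close>

definition hat_fixes :: "nat list \<Rightarrow> nat set" where
  "hat_fixes w = {x \<in> set w. hat w x = x}"

text \<open>The cycle moves each entry to the next one cyclically; with distinct entries this fixes
  something only in a list of length one.\<close>

lemma cycle_of_list_no_fixed_point:
  assumes "distinct (M # B)" "x \<in> set (M # B)" "cycle_of_list (M # B) x = x"
  shows "B = []"
proof -
  let ?cs = "M # B"
  obtain i where i: "i < length ?cs" "x = ?cs ! i" using assms(2) by (metis in_set_conv_nth)
  have "cycle_of_list ?cs x = map (cycle_of_list ?cs ^^ 1) ?cs ! i"
    using i by (simp only: nth_map One_nat_def funpow.simps comp_id)
  also have "\<dots> = rotate 1 ?cs ! i" by (simp only: cyclic_rotation[OF assms(1)])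
  also have "\<dots> = ?cs ! (Suc i mod length ?cs)" using i by (subst nth_rotate) simp_all
  finally have "?cs ! (Suc i mod length ?cs) = ?cs ! i" using assms(3) i by simp
  then have "Suc i mod length ?cs = i"
    using nth_eq_iff_index_eq[OF assms(1), of "Suc i mod length ?cs" i] i
      mod_less_divisor[of "length ?cs" "Suc i"] by simp
  then show "B = []"
    using i by (cases "Suc i = length ?cs") auto
qed

lemma hat_fixes_append_max:
  assumes "distinct (A @ M # B)" "\<forall>x\<in>set A \<union> set B. x < M"
  shows "hat_fixes (A @ M # B) = hat_fixes A \<union> (if B = [] then {M} else {})"
proof -
  have "hat (A @ M # B) x = x \<longleftrightarrow> B = []" if "x \<in> set (M # B)" for x
    using that cycle_of_list_no_fixed_point[of M B x] assms(1)
    unfolding hat_append_max_apply[OF assms] by auto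
  moreover have "hat (A @ M # B) x = hat A x" if "x \<in> set A" for x
    using that assms(1) unfolding hat_append_max_apply[OF assms] by auto
  ultimately show ?thesis unfolding hat_fixes_def by auto
qed

text \<open>The alphabet is arbitrary because the prefix \<open>A\<close> of \<open>A m n B\<close>
  uses the letters of [m-1] - R, which need not be an initial segment.\<close>

definition derangement_words :: "nat set \<Rightarrow> nat list set" where
  "derangement_words S = {w \<in> permutations_of_set S. hat_fixes w = {}}"

lemma finite_derangement_words [simp]: "finite (derangement_words S)"
  by (simp add: derangement_words_def)

lemma card_derangements:
  assumes "finite S"
  shows "card {f. f permutes S \<and> (\<forall>x\<in>S. f x \<noteq> x)} = derangement_number (card S)"
proof -
  obtain h where "bij_betw h S {1..card S}"
    using assms by (metis card_atLeastAtMost diff_Suc_1 finite_atLeastAtMost finite_same_card_bij)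
  from bij_betw_same_card[OF bij_betw_derangements[OF this]] show ?thesis
    by (simp add: derangement_number_def)
qed

text \<open>Surjectivity comes from counting: \<open>hat\<close> is injective and both sets have
  (card S)! elements, so no inverse is constructed.\<close>

lemma bij_betw_hat:
  assumes "finite S"
  shows "bij_betw hat (permutations_of_set S) {f. f permutes S}"
proof -
  have inj: "inj_on hat (permutations_of_set S)"
    by (rule inj_onI) (metis hat_inject permutations_of_setD)
  have "hat ` permutations_of_set S = {f. f permutes S}"
  proof (rule card_subset_eq)
    show "hat ` permutations_of_set S \<subseteq> {f. f permutes S}"
      by (auto dest: permutations_of_setD intro: hat_permutes)
    show "card (hat ` permutations_of_set S) = card {f. f permutes S}"
      using assms by (simp add: card_image[OF inj] card_permutations[OF refl])
  qed (simp add: assms finite_permutations)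
  then show ?thesis using inj by (simp add: bij_betw_def)
qed

lemma card_derangement_words:
  assumes "finite S"
  shows "card (derangement_words S) = derangement_number (card S)"
proof -
  have b: "bij_betw hat (permutations_of_set S) {f. f permutes S}" by (rule bij_betw_hat[OF assms])
  have "derangement_words S = {w \<in> permutations_of_set S. \<forall>x\<in>S. hat w x \<noteq> x}"
    by (auto simp: derangement_words_def hat_fixes_def dest: permutations_of_setD)
  moreover have "bij_betw hat {w \<in> permutations_of_set S. \<forall>x\<in>S. hat w x \<noteq> x}
      {f \<in> {f. f permutes S}. \<forall>x\<in>S. f x \<noteq> x}"
    by (rule bij_betw_Collect[OF b]) simp
  ultimately have "bij_betw hat (derangement_words S) {f. f permutes S \<and> (\<forall>x\<in>S. f x \<noteq> x)}"
    by simp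
  from bij_betw_same_card[OF this] show ?thesis by (simp add: card_derangements[OF assms])
qed

section \<open>Avoiders by their smallest fixed point\<close>

text \<open>Turns a condition on a subword into one on pairs of positions of the full word, the form
  in which pattern occurrences are given.\<close>

lemma sorted_wrt_filter_iff:
  "sorted_wrt R (filter P w) \<longleftrightarrow> sorted_wrt (\<lambda>a b. P a \<longrightarrow> P b \<longrightarrow> R a b) w"
  by (induction w) auto

lemma contains_arrow_23_1_1_iff:
  assumes w: "w \<in> permutations_of_set {1..n}"
  shows "contains_arrow w ([2, 3], {(1, 1)}) \<longleftrightarrow>
    (\<exists>x\<in>hat_fixes w. \<exists>i j. i < j \<and> j < length w \<and> x < w ! i \<and> w ! i < w ! j)"
    (is "_ \<longleftrightarrow> ?R")
proof -
  have size: "pattern_size ([2, 3], {(1, 1)}) = 3"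
    by (rule pattern_size_eq[OF is_arrow_pattern_23_1_1])
  have set_w: "set w = {1..n}" and len: "length w = n"
    using w by (auto dest: permutations_of_setD simp: length_finite_permutations_of_set)
  have three: "{1..3} = {1::nat, 2, 3}" and two: "{..<2} = {0::nat, 1}" by auto
  have "contains_arrow w ([2, 3], {(1, 1)}) \<longleftrightarrow> (\<exists>(x :: nat \<Rightarrow> nat) (t :: nat \<Rightarrow> nat).
      x 1 < x 2 \<and> x 2 < x 3 \<and> {x 1, x 2, x 3} \<subseteq> {1..n} \<and> t 0 < t 1 \<and> {t 0, t 1} \<subseteq> {..<n} \<and>
      w ! t 0 = x 2 \<and> w ! t 1 = x 3 \<and> hat w (x 1) = x 1)"
  proof -
    have x_mono: "strict_mono_on {1..3} x \<longleftrightarrow> x 1 < x 2 \<and> x 2 < x 3" for x :: "nat \<Rightarrow> nat"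
      unfolding three strict_mono_on_def by auto
    have t_mono: "strict_mono_on {..<2} t \<longleftrightarrow> t 0 < t 1" for t :: "nat \<Rightarrow> nat"
      unfolding two strict_mono_on_def by auto
    have all_two: "(\<forall>j<2. Q j) \<longleftrightarrow> Q 0 \<and> Q 1" for Q :: "nat \<Rightarrow> bool"
      by (auto simp: less_2_cases_iff)
    have len2: "length [2, 3 :: nat] = 2" by simp
    show ?thesis
      unfolding contains_arrow_def Let_def size fst_conv snd_conv len len2 x_mono t_mono all_two
      unfolding three two by simp
  qed
  also have "\<dots> \<longleftrightarrow> ?R"
  proof
    assume ?R
    then obtain x i j where "x \<in> hat_fixes w" "i < j" "j < length w" "x < w ! i" "w ! i < w ! j"
      by blast
    moreover from this have "w ! i \<in> {1..n}" "w ! j \<in> {1..n}" unfolding set_w[symmetric] by auto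
    ultimately show "\<exists>(x :: nat \<Rightarrow> nat) (t :: nat \<Rightarrow> nat).
      x 1 < x 2 \<and> x 2 < x 3 \<and> {x 1, x 2, x 3} \<subseteq> {1..n} \<and> t 0 < t 1 \<and> {t 0, t 1} \<subseteq> {..<n} \<and>
      w ! t 0 = x 2 \<and> w ! t 1 = x 3 \<and> hat w (x 1) = x 1"
      using len set_w
      \<comment> \<open>Only the values at 1, 2, 3 and at 0, 1 matter; each last branch also serves
        as the default elsewhere.\<close>
      by (intro exI[of _ "\<lambda>k. if k = 1 then x else if k = 2 then w ! i else w ! j"]
          exI[of _ "\<lambda>k. if k = 0 then i else j"]) (simp add: hat_fixes_def)
  next
    assume "\<exists>(x :: nat \<Rightarrow> nat) (t :: nat \<Rightarrow> nat).
      x 1 < x 2 \<and> x 2 < x 3 \<and> {x 1, x 2, x 3} \<subseteq> {1..n} \<and> t 0 < t 1 \<and> {t 0, t 1} \<subseteq> {..<n} \<and>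
      w ! t 0 = x 2 \<and> w ! t 1 = x 3 \<and> hat w (x 1) = x 1"
    then obtain x t :: "nat \<Rightarrow> nat" where
      "x 1 < x 2" "x 2 < x 3" "{x 1, x 2, x 3} \<subseteq> {1..n}" "t 0 < t 1" "{t 0, t 1} \<subseteq> {..<n}"
      "w ! t 0 = x 2" "w ! t 1 = x 3" "hat w (x 1) = x 1" by blast
    then show ?R
      by (intro bexI[of _ "x 1"] exI[of _ "t 0"] exI[of _ "t 1"]) (auto simp: hat_fixes_def set_w len)
  qed
  finally show ?thesis .
qed

lemma arrow_avoiders_23_1_1_eq:
  "arrow_avoiders n ([2, 3], {(1, 1)}) =
    {w \<in> permutations_of_set {1..n}. \<forall>x\<in>hat_fixes w. sorted_wrt (>) (filter ((<) x) w)}"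
proof -
  have "(\<not> contains_arrow w ([2, 3], {(1, 1)})) \<longleftrightarrow>
      (\<forall>x\<in>hat_fixes w. sorted_wrt (>) (filter ((<) x) w))"
    if w: "w \<in> permutations_of_set {1..n}" for w
  proof -
    have d: "distinct w" using w by (rule permutations_of_setD)
    have "(\<forall>i j. i < j \<and> j < length w \<longrightarrow> x < w ! i \<longrightarrow> \<not> w ! i < w ! j) \<longleftrightarrow>
        sorted_wrt (>) (filter ((<) x) w)" for x
    proof -
      \<comment> \<open>The extra premise \<open>x < w ! j\<close> is harmless, as an ascent
        starting above \<open>x\<close> also ends above \<open>x\<close>; distinctness turns "not
        increasing" into "decreasing".\<close>
      have "(i < j \<and> j < length w \<longrightarrow> x < w ! i \<longrightarrow> \<not> w ! i < w ! j) \<longleftrightarrow>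
          (i < j \<longrightarrow> j < length w \<longrightarrow> x < w ! i \<longrightarrow> x < w ! j \<longrightarrow> w ! j < w ! i)" for i j
        using nth_eq_iff_index_eq[OF d, of i j]
        by (cases "w ! i" "w ! j" rule: linorder_cases) auto
      then show ?thesis
        unfolding sorted_wrt_filter_iff unfolding sorted_wrt_iff_nth_less by (simp only:)
    qed
    then show ?thesis unfolding contains_arrow_23_1_1_iff[OF w] by blast
  qed
  then show ?thesis unfolding arrow_avoiders_def by blast
qed

section \<open>Avoiders with a given smallest fixed point\<close>

definition avoiders_with_first_fix :: "nat \<Rightarrow> nat \<Rightarrow> nat list set" where
  "avoiders_with_first_fix n m = {w \<in> permutations_of_set {1..n}.
     m \<in> hat_fixes w \<and> (\<forall>x\<in>hat_fixes w. m \<le> x) \<and> sorted_wrt (>) (filter ((<) m) w)}"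

lemma finite_avoiders_with_first_fix [simp]: "finite (avoiders_with_first_fix n m)"
  by (simp add: avoiders_with_first_fix_def)

text \<open>The letters above a larger fixed point form a subword of those above the smallest one,
  so the condition at the smallest fixed point implies all the others.\<close>

lemma arrow_avoiders_23_1_1_partition:
  "arrow_avoiders n ([2, 3], {(1, 1)}) =
    derangement_words {1..n} \<union> (\<Union>m\<in>{1..n}. avoiders_with_first_fix n m)"
proof (intro equalityI subsetI)
  fix w assume "w \<in> arrow_avoiders n ([2, 3], {(1, 1)})"
  then have w: "w \<in> permutations_of_set {1..n}"
    and s: "\<forall>x\<in>hat_fixes w. sorted_wrt (>) (filter ((<) x) w)"
    unfolding arrow_avoiders_23_1_1_eq by auto
  have sub: "hat_fixes w \<subseteq> {1..n}" using w by (auto simp: hat_fixes_def dest: permutations_of_setD)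
  show "w \<in> derangement_words {1..n} \<union> (\<Union>m\<in>{1..n}. avoiders_with_first_fix n m)"
  proof (cases "hat_fixes w = {}")
    case False
    have fin: "finite (hat_fixes w)" using sub finite_subset by blast
    have "Min (hat_fixes w) \<in> hat_fixes w" using False fin by simp
    moreover from this have "w \<in> avoiders_with_first_fix n (Min (hat_fixes w))"
      using w s fin by (simp add: avoiders_with_first_fix_def)
    ultimately show ?thesis using sub by blast
  qed (use w in \<open>simp add: derangement_words_def\<close>)
next
  fix w assume "w \<in> derangement_words {1..n} \<union> (\<Union>m\<in>{1..n}. avoiders_with_first_fix n m)"
  moreover have "sorted_wrt (>) (filter ((<) x) w)"
    if "sorted_wrt (>) (filter ((<) m) w)" "m \<le> x" for m x :: nat
  proof -
    have "filter ((<) x) w = filter ((<) x) (filter ((<) m) w)"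
      unfolding filter_filter by (rule filter_cong) (use that(2) in auto)
    then show ?thesis using sorted_wrt_filter[OF that(1)] by simp
  qed
  ultimately show "w \<in> arrow_avoiders n ([2, 3], {(1, 1)})"
    unfolding arrow_avoiders_23_1_1_eq
    by (auto simp: derangement_words_def avoiders_with_first_fix_def)
qed

lemma split_at_max_permutation:
  fixes n :: nat
  assumes "w \<in> permutations_of_set {1..n}" "n \<ge> 1"
  obtains A B where "w = A @ n # B" "\<forall>x\<in>set A \<union> set B. x < n" "distinct (A @ n # B)"
proof -
  have s: "set w = {1..n}" and d: "distinct w" using assms(1) by (auto dest: permutations_of_setD)
  have "n \<in> set w" unfolding s using assms(2) by simp
  then obtain A B where w: "w = A @ n # B" by (meson split_list)
  have d': "distinct (A @ n # B)" using d w by simp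
  have "set A \<union> set B \<subseteq> {1..n}" using s w by auto
  moreover have "n \<notin> set A \<union> set B" using d' by simp
  ultimately have "\<forall>x\<in>set A \<union> set B. x < n" by (metis atLeastAtMost_iff le_neq_implies_less subsetD)
  then show ?thesis using that w d' by blast
qed

text \<open>The block opened by \<open>n\<close> must be a singleton, which puts \<open>n\<close>
  last, and minimality leaves no fixed point in the prefix. No letter exceeds \<open>n\<close>, so
  the order condition is vacuous.\<close>

lemma avoiders_with_first_fix_max:
  assumes "n \<ge> 1"
  shows "avoiders_with_first_fix n n = (\<lambda>A. A @ [n]) ` derangement_words {1..n - 1}"
proof (intro equalityI subsetI)
  fix w assume "w \<in> avoiders_with_first_fix n n"
  then have w: "w \<in> permutations_of_set {1..n}" and n: "n \<in> hat_fixes w"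
    and le: "\<forall>x\<in>hat_fixes w. n \<le> x" by (auto simp: avoiders_with_first_fix_def)
  obtain A B where AB: "w = A @ n # B" and lt: "\<forall>x\<in>set A \<union> set B. x < n" and d: "distinct (A @ n # B)"
    using split_at_max_permutation[OF w assms] .
  note fix_w = hat_fixes_append_max[OF d lt, folded AB]
  have sub: "hat_fixes A \<subseteq> set A" by (auto simp: hat_fixes_def)
  have "n \<notin> hat_fixes A" using sub d by auto
  then have B: "B = []" using n fix_w by (auto split: if_splits)
  have "hat_fixes A = {}"
  proof (intro equals0I)
    fix x assume "x \<in> hat_fixes A"
    then have "n \<le> x" "x < n" using le lt sub fix_w by auto
    then show False by simp
  qed
  moreover have "set A = {1..n - 1}"
  proof -
    have "insert n (set A) = {1..n}" using permutations_of_setD(1)[OF w] AB B by simp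
    moreover have "n \<notin> set A" using d by simp
    ultimately have "set A = {1..n} - {n}" by blast
    also have "\<dots> = {1..n - 1}" using assms by auto
    finally show ?thesis .
  qed
  ultimately have "A \<in> derangement_words {1..n - 1}" using d by (auto simp: derangement_words_def)
  then show "w \<in> (\<lambda>A. A @ [n]) ` derangement_words {1..n - 1}" using AB B by blast
next
  fix w assume "w \<in> (\<lambda>A. A @ [n]) ` derangement_words {1..n - 1}"
  then obtain A where w: "w = A @ [n]" and A: "distinct A" "set A = {1..n - 1}" "hat_fixes A = {}"
    by (auto simp: derangement_words_def dest: permutations_of_setD)
  have d: "distinct (A @ [n])" and lt: "\<forall>x\<in>set A \<union> set []. x < n" using A assms by auto
  have "hat_fixes w = {n}" using hat_fixes_append_max[OF d lt] A(3) w by simp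
  moreover have "filter ((<) n) w = []" using lt w by (auto simp: filter_empty_conv)
  moreover have "set w = {1..n}" using w A(2) assms by auto
  ultimately show "w \<in> avoiders_with_first_fix n n"
    using d w by (simp add: avoiders_with_first_fix_def permutations_of_set_def)
qed

lemma card_avoiders_with_first_fix_max:
  assumes "n \<ge> 1"
  shows "card (avoiders_with_first_fix n n) = derangement_number (n - 1)"
proof -
  have "inj_on (\<lambda>A. A @ [n]) (derangement_words {1..n - 1})" by (simp add: inj_on_def)
  then show ?thesis
    by (simp add: avoiders_with_first_fix_max[OF assms] card_image card_derangement_words)
qed

section \<open>Counting the tails by shuffles\<close>

text \<open>The candidates for \<open>B\<close> in \<open>A m n B\<close>: \<open>R\<close> stands
  for the letters of \<open>B\<close> below \<open>m\<close>, \<open>T\<close> for those above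
  \<open>m\<close>.\<close>

definition tail_words :: "nat \<Rightarrow> nat set \<Rightarrow> nat set \<Rightarrow> nat list set" where
  "tail_words m R T = {B \<in> permutations_of_set (R \<union> T). sorted_wrt (>) (filter ((<) m) B)}"

lemma finite_tail_words [simp]: "finite (tail_words m R T)"
  by (simp add: tail_words_def)

text \<open>Every word is a shuffle of its letters up to \<open>m\<close> and its letters above
  \<open>m\<close>; the latter must be \<open>T\<close> in decreasing order, while the former may be
  any ordering of \<open>R\<close>.\<close>

lemma tail_words_eq:
  assumes "finite T" "R \<subseteq> {..m}" "T \<subseteq> {m<..}"
  shows "tail_words m R T = (\<Union>xs\<in>permutations_of_set R. shuffles xs (rev (sorted_list_of_set T)))"
proof (intro equalityI subsetI)
  let ?ys = "rev (sorted_list_of_set T)"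
  {
    fix B assume "B \<in> tail_words m R T"
    then have B: "distinct B" "set B = R \<union> T" "sorted_wrt (>) (filter ((<) m) B)"
      by (auto simp: tail_words_def dest: permutations_of_setD)
    have "rev (filter ((<) m) B) = sorted_list_of_set T"
    proof (rule strict_sorted_equal)
      show "sorted_wrt (<) (rev (filter ((<) m) B))" using B(3) by (simp add: sorted_wrt_rev)
      show "set (rev (filter ((<) m) B)) = set (sorted_list_of_set T)"
        using assms B(2) by auto
    qed simp
    then have "filter ((<) m) B = ?ys" by (metis rev_rev_ident)
    moreover have "filter (\<lambda>x. \<not> m < x) B \<in> permutations_of_set R"
      using assms B(1,2) by (intro permutations_of_setI) auto
    moreover have "B \<in> shuffles (filter (\<lambda>x. \<not> m < x) B) (filter ((<) m) B)"
      using partition_in_shuffles[of B "(<) m"] by (subst shuffles_commutes)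
    ultimately show "B \<in> (\<Union>xs\<in>permutations_of_set R. shuffles xs ?ys)" by auto
  }
  fix B assume "B \<in> (\<Union>xs\<in>permutations_of_set R. shuffles xs ?ys)"
  then obtain xs where xs: "set xs = R" "distinct xs" and B: "B \<in> shuffles xs ?ys"
    by (auto dest: permutations_of_setD)
  have disj: "set xs \<inter> set ?ys = {}" using assms xs by fastforce
  have s: "set B = R \<union> T" using set_shuffles[OF B] xs assms by simp
  have "filter ((<) m) B = filter (\<lambda>x. x \<notin> set xs) B"
    by (rule filter_cong) (use s xs assms in auto)
  also have "\<dots> = ?ys" using filter_shuffles_disjoint1(2)[OF disj B] .
  finally have "sorted_wrt (>) (filter ((<) m) B)" by (simp add: sorted_wrt_rev)
  moreover have "distinct B"
    using distinct_disjoint_shuffles[OF xs(2) _ disj B] by simp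
  ultimately show "B \<in> tail_words m R T" using s by (auto simp: tail_words_def)
qed

text \<open>The binomial coefficient counts the shuffles for one ordering of \<open>R\<close>.
  Different orderings give disjoint sets, since filtering a shuffle by \<open>R\<close> recovers the
  ordering.\<close>

lemma card_tail_words:
  assumes "finite T" "R \<subseteq> {..m}" "T \<subseteq> {m<..}"
  shows "card (tail_words m R T) = fact (card R) * ((card R + card T) choose card R)"
proof -
  let ?ys = "rev (sorted_list_of_set T)"
  have fin: "finite R" using assms(2) finite_subset by blast
  have disj: "set xs \<inter> set ?ys = {}" if "xs \<in> permutations_of_set R" for xs
    using assms permutations_of_setD(1)[OF that] by fastforce
  have "card (tail_words m R T) = (\<Sum>xs\<in>permutations_of_set R. card (shuffles xs ?ys))"
    unfolding tail_words_eq[OF assms]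
  proof (rule card_UN_disjoint)
    show "\<forall>xs\<in>permutations_of_set R. \<forall>zs\<in>permutations_of_set R.
        xs \<noteq> zs \<longrightarrow> shuffles xs ?ys \<inter> shuffles zs ?ys = {}"
    proof (intro ballI impI equals0I)
      fix xs zs B
      assume xs: "xs \<in> permutations_of_set R" and zs: "zs \<in> permutations_of_set R" and "xs \<noteq> zs"
        and B: "B \<in> shuffles xs ?ys \<inter> shuffles zs ?ys"
      have "xs = filter (\<lambda>x. x \<in> R) B" "zs = filter (\<lambda>x. x \<in> R) B"
        using filter_shuffles_disjoint1(1)[OF disj[OF xs], of B]
          filter_shuffles_disjoint1(1)[OF disj[OF zs], of B] B
          permutations_of_setD(1)[OF xs] permutations_of_setD(1)[OF zs] by auto
      then show False using \<open>xs \<noteq> zs\<close> by simp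
    qed
  qed auto
  also have "\<dots> = (\<Sum>xs\<in>permutations_of_set R. (card R + card T) choose card R)"
    by (rule sum.cong[OF refl])
      (use fin in \<open>simp add: card_disjoint_shuffles[OF disj] length_finite_permutations_of_set\<close>)
  also have "\<dots> = fact (card R) * ((card R + card T) choose card R)" using fin by simp
  finally show ?thesis .
qed

section \<open>The case of a smallest fixed point below \<open>n\<close>\<close>

text \<open>A letter above \<open>m\<close> in front of \<open>n\<close> would form a forbidden
  ascent with \<open>n\<close>, so \<open>m\<close> is the maximum of the part before
  \<open>n\<close>. Its block there is a singleton, hence \<open>m\<close> stands right before
  \<open>n\<close>.\<close>

lemma avoiders_with_first_fix_eq:
  assumes "1 \<le> m" "m < n"
  shows "avoiders_with_first_fix n m = (\<lambda>(R, A, B). A @ m # n # B) `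
    (SIGMA R:Pow {1..m - 1}. derangement_words ({1..m - 1} - R) \<times> tail_words m R {m + 1..n - 1})"
    (is "_ = ?F ` ?S")
proof (intro equalityI subsetI)
  fix w assume "w \<in> avoiders_with_first_fix n m"
  then have w: "w \<in> permutations_of_set {1..n}" and m: "m \<in> hat_fixes w"
    and le: "\<forall>x\<in>hat_fixes w. m \<le> x" and sorted: "sorted_wrt (>) (filter ((<) m) w)"
    by (auto simp: avoiders_with_first_fix_def)
  obtain C B where CB: "w = C @ n # B" and lt: "\<forall>x\<in>set C \<union> set B. x < n"
    and d: "distinct (C @ n # B)"
    using split_at_max_permutation[OF w] assms by auto
  note fix_w = hat_fixes_append_max[OF d lt, folded CB]
  \<comment> \<open>The last block can only contribute the fixed point \<open>n\<close>, which
    differs from \<open>m\<close>.\<close>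
  have mC: "m \<in> hat_fixes C" using m assms fix_w by (auto split: if_splits)
  then have m_in: "m \<in> set C" by (simp add: hat_fixes_def)
  have C_le: "x \<le> m" if "x \<in> set C" for x
  proof (rule ccontr)
    assume "\<not> x \<le> m"
    then have "n < x" using sorted assms that by (auto simp: CB sorted_wrt_append)
    moreover have "x < n" using lt that by blast
    ultimately show False by simp
  qed
  have "distinct C" "C \<noteq> []" using d m_in by auto
  then obtain A M D where CM: "C = A @ M # D" and ltM: "\<forall>x\<in>set A \<union> set D. x < M"
    by (rule max_split)
  have "M = m"
  proof (rule order_antisym)
    show "M \<le> m" using C_le[of M] CM by simp
    show "m \<le> M" using m_in ltM CM by (auto intro: less_imp_le)
  qed
  then have C: "C = A @ m # D" and ltm: "\<forall>x\<in>set A \<union> set D. x < m" using CM ltM by auto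
  have dC: "distinct (A @ m # D)" using d unfolding C by (simp only: distinct_append)
  note fix_C = hat_fixes_append_max[OF dC ltm, folded C]
  have sub: "hat_fixes A \<subseteq> set A" by (auto simp: hat_fixes_def)
  have "m \<notin> hat_fixes A" using sub dC by auto
  then have D: "D = []" using mC fix_C by (auto split: if_splits)
  have "hat_fixes A = {}"
  proof (intro equals0I)
    fix x assume "x \<in> hat_fixes A"
    then have "m \<le> x" "x < m" using le ltm sub fix_w fix_C by auto
    then show False by simp
  qed
  \<comment> \<open>The small letters missing from \<open>A\<close> are exactly those that must
    occur in \<open>B\<close>.\<close>
  moreover define R where "R = {1..m - 1} - set A"
  have set_w: "set A \<union> {m, n} \<union> set B = {1..n}"
    using permutations_of_setD(1)[OF w] CB C D by auto
  have "set A \<subseteq> {1..m - 1}"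
  proof
    fix x assume x: "x \<in> set A"
    then have "x \<in> {1..n}" "x < m" using set_w ltm by blast+
    then show "x \<in> {1..m - 1}" by simp
  qed
  then have set_A: "set A = {1..m - 1} - R" unfolding R_def by blast
  moreover have "set B = R \<union> {m + 1..n - 1}"
  proof -
    have "set B \<inter> (set A \<union> {m, n}) = {}" using d C D by auto
    then have "set B = {1..n} - (set A \<union> {m, n})" using set_w by blast
    also have "\<dots> = ({1..m - 1} - set A) \<union> ({m + 1..n - 1} - set A)"
      using assms \<open>set A \<subseteq> {1..m - 1}\<close> by auto
    also have "{m + 1..n - 1} - set A = {m + 1..n - 1}"
    proof -
      have "{m + 1..n - 1} \<inter> {1..m - 1} = {}" by auto
      then show ?thesis using \<open>set A \<subseteq> {1..m - 1}\<close> by blast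
    qed
    finally show ?thesis by (simp add: R_def)
  qed
  moreover have "sorted_wrt (>) (filter ((<) m) B)"
    using sorted assms by (simp add: CB sorted_wrt_append)
  ultimately have "(R, A, B) \<in> ?S"
    using d C by (auto simp: derangement_words_def tail_words_def permutations_of_set_def R_def)
  moreover have "w = ?F (R, A, B)" using CB C D by simp
  ultimately show "w \<in> ?F ` ?S" by blast
next
  fix w assume "w \<in> ?F ` ?S"
  then obtain R A B where R: "R \<subseteq> {1..m - 1}" and w: "w = A @ m # n # B"
    and A: "distinct A" "set A = {1..m - 1} - R" "hat_fixes A = {}"
    and B: "distinct B" "set B = R \<union> {m + 1..n - 1}" "sorted_wrt (>) (filter ((<) m) B)"
    by (auto simp: derangement_words_def tail_words_def permutations_of_set_def)
  \<comment> \<open>Bracketed so that the maximum \<open>n\<close> is split off first and then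
    \<open>m\<close>, the maximum of \<open>A @ [m]\<close>.\<close>
  have d: "distinct ((A @ [m]) @ n # B)" using A B R assms by auto
  have "set A \<union> R \<subseteq> {..<m}" using A(2) R assms by fastforce
  then have lt: "\<forall>x\<in>set (A @ [m]) \<union> set B. x < n" using B(2) assms by fastforce
  have d': "distinct (A @ m # [])" and lt': "\<forall>x\<in>set A \<union> set []. x < m" using d A assms by auto
  \<comment> \<open>For empty \<open>B\<close> the letter \<open>n\<close> is a second fixed point,
    but \<open>m < n\<close> keeps \<open>m\<close> the smallest.\<close>
  have fix_w: "hat_fixes w = {m} \<union> (if B = [] then {n} else {})"
    using hat_fixes_append_max[OF d lt] hat_fixes_append_max[OF d' lt'] A(3) w by simp
  have "filter ((<) m) A = []" using lt' by (auto simp: filter_empty_conv)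
  then have "filter ((<) m) w = n # filter ((<) m) B" using w assms by simp
  moreover have "set w = {1..n}"
  proof -
    have "set w = {1..m - 1} \<union> {m, n} \<union> {m + 1..n - 1}" using w A(2) B(2) R by auto
    also have "\<dots> = {1..n}" using assms by auto
    finally show ?thesis .
  qed
  moreover have "distinct w" using d w by simp
  ultimately show "w \<in> avoiders_with_first_fix n m"
    using fix_w lt B(3) assms by (auto simp: avoiders_with_first_fix_def permutations_of_set_def)
qed

text \<open>The first occurrence of \<open>x\<close> marks the cut.\<close>

lemma append_Cons_eq_iff_notin:
  assumes "x \<notin> set A" "x \<notin> set A'"
  shows "A @ x # B = A' @ x # B' \<longleftrightarrow> A = A' \<and> B = B'"
proof
  assume eq: "A @ x # B = A' @ x # B'"
  have "takeWhile (\<lambda>y. y \<noteq> x) (A @ x # B) = A" "takeWhile (\<lambda>y. y \<noteq> x) (A' @ x # B') = A'"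
    using assms by (auto simp: takeWhile_append)
  then show "A = A' \<and> B = B'" using eq by simp
qed simp

lemma card_avoiders_with_first_fix:
  assumes "1 \<le> m" "m < n"
  shows "card (avoiders_with_first_fix n m) = (\<Sum>r = 0..m - 1.
    ((m - 1) choose r) * ((n - m + r - 1) choose r) * fact r * derangement_number (m - 1 - r))"
proof -
  let ?F = "\<lambda>(R, A, B). A @ m # n # B"
  let ?U = "{1..m - 1}" and ?T = "{m + 1..n - 1}"
  let ?h = "\<lambda>r. ((n - m + r - 1) choose r) * fact r * derangement_number (m - 1 - r)"
  let ?S = "SIGMA R:Pow ?U. derangement_words (?U - R) \<times> tail_words m R ?T"
  have "inj_on ?F ?S"
  proof (rule inj_onI)
    fix p q assume pq: "p \<in> ?S" "q \<in> ?S" "?F p = ?F q"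
    obtain R A B R' A' B' where p: "p = (R, A, B)" and q: "q = (R', A', B')"
      by (metis prod_cases3)
    have R: "R \<subseteq> ?U" "R' \<subseteq> ?U" and eq: "A @ m # n # B = A' @ m # n # B'"
      and "A \<in> derangement_words (?U - R)" "A' \<in> derangement_words (?U - R')"
      using pq p q by auto
    then have A: "set A = ?U - R" "set A' = ?U - R'"
      by (auto simp: derangement_words_def dest: permutations_of_setD)
    then have "m \<notin> set A" "m \<notin> set A'" using assms by auto
    then have "A = A'" "B = B'" using eq by (simp_all add: append_Cons_eq_iff_notin)
    \<comment> \<open>\<open>R\<close> is the complement of \<open>set A\<close> in
      \<open>{1..m - 1}\<close>, so the word determines it.\<close>
    moreover from this have "R = R'" using A R by blast
    ultimately show "p = q" using p q by simp
  qed
  then have "card (avoiders_with_first_fix n m) = card ?S"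
    unfolding avoiders_with_first_fix_eq[OF assms] by (rule card_image)
  also have "\<dots> = (\<Sum>R\<in>Pow ?U. card (derangement_words (?U - R)) * card (tail_words m R ?T))"
    by (subst card_SigmaI) (simp_all add: card_cartesian_product)
  also have "\<dots> = (\<Sum>R\<in>Pow ?U. ?h (card R))"
  proof (rule sum.cong[OF refl])
    fix R assume "R \<in> Pow ?U"
    then have R: "R \<subseteq> ?U" "finite R" by (auto intro: finite_subset)
    have "?U \<subseteq> {..m}" by auto
    then have Rm: "R \<subseteq> {..m}" using R(1) by blast
    have "card (tail_words m R ?T) = fact (card R) * ((card R + card ?T) choose card R)"
      by (rule card_tail_words[OF _ Rm]) auto
    \<comment> \<open>There are \<open>n - 1 - m\<close> letters strictly between \<open>m\<close>
      and \<open>n\<close>; \<open>m < n\<close> keeps the subtraction exact.\<close>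
    moreover have "card R + card ?T = n - m + card R - 1" using assms by simp
    moreover have "card (?U - R) = m - 1 - card R" using R by (simp add: card_Diff_subset)
    ultimately show "card (derangement_words (?U - R)) * card (tail_words m R ?T) = ?h (card R)"
      by (simp add: card_derangement_words mult_ac)
  qed
  \<comment> \<open>The summand depends on \<open>R\<close> only through its size, so the subsets
    are grouped by cardinality.\<close>
  also have "\<dots> = (\<Sum>r = 0..m - 1. \<Sum>R\<in>{R. R \<in> Pow ?U \<and> card R = r}. ?h (card R))"
  proof (rule sum.group[symmetric])
    show "card ` Pow ?U \<subseteq> {0..m - 1}"
      using card_mono[of ?U] by fastforce
  qed simp_all
  also have "\<dots> = (\<Sum>r = 0..m - 1. ((m - 1) choose r) * ?h r)"
  proof (rule sum.cong[OF refl])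
    fix r
    have "(\<Sum>R\<in>{R. R \<in> Pow ?U \<and> card R = r}. ?h (card R)) = card {R. R \<subseteq> ?U \<and> card R = r} * ?h r"
      by simp
    then show "(\<Sum>R\<in>{R. R \<in> Pow ?U \<and> card R = r}. ?h (card R)) = ((m - 1) choose r) * ?h r"
      by (simp add: n_subsets)
  qed
  finally show ?thesis by (simp add: mult.assoc)
qed

theorem theorem5p5:
  fixes n :: nat
  assumes "n \<ge> 1"
  shows "card (arrow_avoiders n ([2, 3], {(1, 1)})) =
           derangement_number n + derangement_number (n - 1) +
           (\<Sum>m = 1..n - 1. \<Sum>r = 0..m - 1.
              ((m - 1) choose r) * ((n - m + r - 1) choose r) * fact r *
              derangement_number (m - 1 - r))"
proof -
  have disj: "avoiders_with_first_fix n m \<inter> avoiders_with_first_fix n m' = {}" if "m \<noteq> m'" for m m'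
    using that by (force simp: avoiders_with_first_fix_def)
  have "card (arrow_avoiders n ([2, 3], {(1, 1)})) =
      card (derangement_words {1..n}) + card (\<Union>m\<in>{1..n}. avoiders_with_first_fix n m)"
    unfolding arrow_avoiders_23_1_1_partition
    by (rule card_Un_disjoint) (auto simp: derangement_words_def avoiders_with_first_fix_def)
  also have "card (\<Union>m\<in>{1..n}. avoiders_with_first_fix n m) =
      (\<Sum>m = 1..n. card (avoiders_with_first_fix n m))"
    by (rule card_UN_disjoint) (use disj in auto)
  also have "\<dots> = derangement_number (n - 1) + (\<Sum>m = 1..n - 1. card (avoiders_with_first_fix n m))"
  proof -
    \<comment> \<open>The class \<open>m = n\<close> is split off, as it contributes the separate
      derangement number of \<open>n - 1\<close>; for \<open>n = 1\<close> nothing else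
      remains.\<close>
    have "{1..n} = insert n {1..n - 1}" using assms by auto
    then show ?thesis using assms by (simp add: card_avoiders_with_first_fix_max)
  qed
  finally have "card (arrow_avoiders n ([2, 3], {(1, 1)})) = card (derangement_words {1..n}) +
      (derangement_number (n - 1) + (\<Sum>m = 1..n - 1. card (avoiders_with_first_fix n m)))" .
  moreover have "card (derangement_words {1..n}) = derangement_number n"
    by (simp add: card_derangement_words)
  moreover have "(\<Sum>m = 1..n - 1. card (avoiders_with_first_fix n m)) =
      (\<Sum>m = 1..n - 1. \<Sum>r = 0..m - 1.
        ((m - 1) choose r) * ((n - m + r - 1) choose r) * fact r * derangement_number (m - 1 - r))"
    by (rule sum.cong[OF refl], rule card_avoiders_with_first_fix) auto
  ultimately show ?thesis by simp
qed

end
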